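(* For every integer $t\geq 2$ we have $f_o(t)\leq f_{eo}(t)\leq 2f(t)$.
   Context: All graphs are loopless. $f(t)$ is the smallest integer such that every graph with no $K_t$-minor is properly $f(t)$-colorable. An odd-$K_t$-minor of a graph $G$ is a 2-coloring of the vertices of $G$ together with vertex-disjoint trees $T_1,\dots,T_t$ in $G$ such that (i) every edge of every $T_i$ is properly colored (endpoints of different colors) and (ii) between any two distinct trees $T_i,T_j$ there is a monochromatic edge. An even-odd-$K_t$-minor is defined the same way except that (ii) is replaced by: between any two distinct trees $T_i,T_j$ there is at least one monochromatic edge and at least one properly colored edge. $f_o(t)$ (resp. $f_{eo}(t)$) is the smallest integer such that every graph with no odd-$K_t$-minor (resp. no even-odd-$K_t$-minor) is properly $f_o(t)$-colorable (resp. $f_{eo}(t)$-colorable). *)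

theory Defs
  imports Main
begin

text \<open>A finite loopless (simple) graph: vertex set V and a set E of 2-element
subsets of V. Vertices are natural numbers (every finite graph is isomorphic to such a graph).\<close>

type_synonym graph = "nat set \<times> nat set set"

definition verts :: "graph \<Rightarrow> nat set" where "verts G = fst G"
definition edges :: "graph \<Rightarrow> nat set set" where "edges G = snd G"

definition is_graph :: "graph \<Rightarrow> bool" where
  "is_graph G \<longleftrightarrow> finite (verts G) \<and>
     (\<forall>e\<in>edges G. \<exists>u v. e = {u, v} \<and> u \<noteq> v \<and> u \<in> verts G \<and> v \<in> verts G)"

definition colorable :: "graph \<Rightarrow> nat \<Rightarrow> bool" where
  "colorable G k \<longleftrightarrow> (\<exists>c :: nat \<Rightarrow> nat. (\<forall>v\<in>verts G. c v < k) \<and>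
     (\<forall>u v. {u, v} \<in> edges G \<longrightarrow> c u \<noteq> c v))"

definition is_tree :: "graph \<Rightarrow> nat set \<Rightarrow> nat set set \<Rightarrow> bool" where
  "is_tree G S F \<longleftrightarrow> S \<noteq> {} \<and> S \<subseteq> verts G \<and> F \<subseteq> edges G \<and> (\<forall>e\<in>F. e \<subseteq> S) \<and>
     (\<forall>u\<in>S. \<forall>v\<in>S. (\<lambda>x y. {x, y} \<in> F)\<^sup>*\<^sup>* u v) \<and> card F + 1 = card S"

definition disjoint_trees :: "graph \<Rightarrow> nat \<Rightarrow> (nat \<Rightarrow> nat set \<times> nat set set) \<Rightarrow> bool" where
  "disjoint_trees G t T \<longleftrightarrow> (\<forall>i<t. is_tree G (fst (T i)) (snd (T i))) \<and>
     (\<forall>i<t. \<forall>j<t. i \<noteq> j \<longrightarrow> fst (T i) \<inter> fst (T j) = {})"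

definition has_Kt_minor :: "graph \<Rightarrow> nat \<Rightarrow> bool" where
  "has_Kt_minor G t \<longleftrightarrow> (\<exists>T. disjoint_trees G t T \<and>
     (\<forall>i<t. \<forall>j<t. i \<noteq> j \<longrightarrow> (\<exists>u\<in>fst (T i). \<exists>v\<in>fst (T j). {u, v} \<in> edges G)))"

definition has_odd_Kt_minor :: "graph \<Rightarrow> nat \<Rightarrow> bool" where
  "has_odd_Kt_minor G t \<longleftrightarrow> (\<exists>(col :: nat \<Rightarrow> bool) T. disjoint_trees G t T \<and>
     (\<forall>i<t. \<forall>u v. {u, v} \<in> snd (T i) \<longrightarrow> col u \<noteq> col v) \<and>
     (\<forall>i<t. \<forall>j<t. i \<noteq> j \<longrightarrow>
        (\<exists>u\<in>fst (T i). \<exists>v\<in>fst (T j). {u, v} \<in> edges G \<and> col u = col v)))"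

definition has_even_odd_Kt_minor :: "graph \<Rightarrow> nat \<Rightarrow> bool" where
  "has_even_odd_Kt_minor G t \<longleftrightarrow> (\<exists>(col :: nat \<Rightarrow> bool) T. disjoint_trees G t T \<and>
     (\<forall>i<t. \<forall>u v. {u, v} \<in> snd (T i) \<longrightarrow> col u \<noteq> col v) \<and>
     (\<forall>i<t. \<forall>j<t. i \<noteq> j \<longrightarrow>
        (\<exists>u\<in>fst (T i). \<exists>v\<in>fst (T j). {u, v} \<in> edges G \<and> col u = col v) \<and>
        (\<exists>u\<in>fst (T i). \<exists>v\<in>fst (T j). {u, v} \<in> edges G \<and> col u \<noteq> col v)))"

definition f :: "nat \<Rightarrow> nat" where
  "f t = (LEAST k. \<forall>G. is_graph G \<and> \<not> has_Kt_minor G t \<longrightarrow> colorable G k)"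

definition f_o :: "nat \<Rightarrow> nat" where
  "f_o t = (LEAST k. \<forall>G. is_graph G \<and> \<not> has_odd_Kt_minor G t \<longrightarrow> colorable G k)"

definition f_eo :: "nat \<Rightarrow> nat" where
  "f_eo t = (LEAST k. \<forall>G. is_graph G \<and> \<not> has_even_odd_Kt_minor G t \<longrightarrow> colorable G k)"

end

theory Submission
  imports Defs
begin

text \<open>
  Split the graph greedily into parts, each a maximal connected induced bipartite subgraph of what
  is left. If a vertex of a later part has a neighbour in an earlier part, then by maximality it
  sees both colour classes there. Hence any \<open>K\<^sub>t\<close>-minor of the graph obtained by contracting the
  parts lifts to an even-odd-\<open>K\<^sub>t\<close>-minor, whatever the orientation of the individual bipartitions;
  so the contracted graph is \<open>f t\<close>-colourable, and the pairs (colour of the part, side of the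
  bipartition) colour the original graph.

  For the least numbers to be meaningful one needs that \<open>f t\<close> is finite. This is an
  induction on \<open>t\<close>: explore a graph without a \<open>K\<close>-minor on \<open>t + 1\<close> vertices in layers; each layer is
  dominated by the connected union of the earlier ones and therefore has no \<open>K\<^sub>t\<close>-minor,
  and two alternating palettes suffice for all layers.
\<close>

section \<open>Notions for parts and contractions\<close>

definition induced :: "graph \<Rightarrow> nat set \<Rightarrow> graph" where
  "induced G U = (U, {e \<in> edges G. e \<subseteq> U})"

definition two_coloring_on :: "graph \<Rightarrow> (nat \<Rightarrow> bool) \<Rightarrow> nat set \<Rightarrow> bool" where
  "two_coloring_on G col P \<longleftrightarrow> (\<forall>u\<in>P. \<forall>v\<in>P. {u, v} \<in> edges G \<longrightarrow> col u \<noteq> col v)"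

text \<open>Connectivity is witnessed by a spanning tree, which later becomes a piece of a lifted
  branch tree. The 2-coloring, in contrast, has to be proper on all edges inside \<open>P\<close>,
  not only on those of the tree.\<close>

definition connected_bipartite :: "graph \<Rightarrow> nat set \<Rightarrow> bool" where
  "connected_bipartite G P \<longleftrightarrow> (\<exists>F. is_tree G P F) \<and> (\<exists>col. two_coloring_on G col P)"

text \<open>Quantifying over all 2-colorings serves both directions: the negation yields a coloring
  in which all neighbours of \<open>v\<close> in \<open>P\<close> agree, and the property itself
  applies to whatever orientation of the bipartition a lifted tree imposes.\<close>

definition sees_both_sides :: "graph \<Rightarrow> nat \<Rightarrow> nat set \<Rightarrow> bool" where
  "sees_both_sides G v P \<longleftrightarrow> (\<forall>col. two_coloring_on G col P \<longrightarrow>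
     (\<exists>x\<in>P. \<exists>y\<in>P. {v, x} \<in> edges G \<and> {v, y} \<in> edges G \<and> col x \<noteq> col y))"

definition contraction :: "graph \<Rightarrow> (nat \<Rightarrow> nat) \<Rightarrow> graph" where
  "contraction G h = (h ` verts G,
     {{h u, h v} | u v. {u, v} \<in> edges G \<and> u \<in> verts G \<and> v \<in> verts G \<and> h u \<noteq> h v})"

section \<open>Edges, induced subgraphs and trees\<close>

lemma edge_endpoints:
  assumes "is_graph G" "{u, v} \<in> edges G"
  shows "u \<in> verts G" "v \<in> verts G" "u \<noteq> v"
proof -
  obtain a b where "{u, v} = {a, b}" "a \<noteq> b" "a \<in> verts G" "b \<in> verts G"
    using assms unfolding is_graph_def by blast
  then show "u \<in> verts G" "v \<in> verts G" "u \<noteq> v"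
    by (auto simp: doubleton_eq_iff)
qed

lemma is_graph_induced:
  assumes "is_graph G" "U \<subseteq> verts G"
  shows "is_graph (induced G U)"
proof -
  have "\<exists>u v. e = {u, v} \<and> u \<noteq> v \<and> u \<in> U \<and> v \<in> U" if "e \<in> edges G" "e \<subseteq> U" for e
  proof -
    obtain u v where "e = {u, v}" "u \<noteq> v"
      using assms(1) \<open>e \<in> edges G\<close> unfolding is_graph_def by blast
    then show ?thesis
      using \<open>e \<subseteq> U\<close> by auto
  qed
  moreover have "finite U"
    using assms finite_subset unfolding is_graph_def by blast
  ultimately show ?thesis
    unfolding is_graph_def induced_def verts_def edges_def by simp
qed

lemma is_tree_induced:
  assumes "is_tree (induced G U) S F" "U \<subseteq> verts G"
  shows "is_tree G S F" "S \<subseteq> U"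
  using assms unfolding is_tree_def induced_def verts_def edges_def by auto

text \<open>The count \<open>card F + 1 = card S\<close> makes \<open>card S\<close> positive,
  whereas an infinite set has cardinality 0.\<close>

lemma is_tree_finite:
  assumes "is_tree G S F"
  shows "finite S" "finite F"
proof -
  have "card S > 0"
    using assms unfolding is_tree_def by linarith
  then show "finite S"
    using card_ge_0_finite by blast
  moreover have "F \<subseteq> Pow S"
    using assms unfolding is_tree_def by blast
  ultimately show "finite F"
    using finite_subset by blast
qed

lemma is_tree_singleton: "v \<in> verts G \<Longrightarrow> is_tree G {v} {}"
  unfolding is_tree_def by simp

lemma is_tree_join:
  assumes G: "is_graph G" and t1: "is_tree G S1 F1" and t2: "is_tree G S2 F2"
    and disj: "S1 \<inter> S2 = {}" and u1: "u1 \<in> S1" and u2: "u2 \<in> S2" and e: "{u1, u2} \<in> edges G"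
  shows "is_tree G (S1 \<union> S2) (insert {u1, u2} (F1 \<union> F2))"
proof -
  let ?F = "insert {u1, u2} (F1 \<union> F2)"
  let ?R = "\<lambda>x y. {x, y} \<in> ?F"
  note fin = is_tree_finite[OF t1] is_tree_finite[OF t2]
  have sub1: "\<forall>e\<in>F1. e \<subseteq> S1" and sub2: "\<forall>e\<in>F2. e \<subseteq> S2"
    using t1 t2 unfolding is_tree_def by auto
  have inner1: "?R\<^sup>*\<^sup>* x y" if "x \<in> S1" "y \<in> S1" for x y
  proof -
    have "(\<lambda>x y. {x, y} \<in> F1)\<^sup>*\<^sup>* x y"
      using t1 that unfolding is_tree_def by auto
    then show ?thesis
      by (rule rtranclp_mono[THEN predicate2D, rotated]) auto
  qed
  have inner2: "?R\<^sup>*\<^sup>* x y" if "x \<in> S2" "y \<in> S2" for x y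
  proof -
    have "(\<lambda>x y. {x, y} \<in> F2)\<^sup>*\<^sup>* x y"
      using t2 that unfolding is_tree_def by auto
    then show ?thesis
      by (rule rtranclp_mono[THEN predicate2D, rotated]) auto
  qed
  have bridge: "?R\<^sup>*\<^sup>* u1 u2" "?R\<^sup>*\<^sup>* u2 u1"
    by (auto intro!: r_into_rtranclp simp: insert_commute)
  have "?R\<^sup>*\<^sup>* x u1 \<and> ?R\<^sup>*\<^sup>* u1 x" if "x \<in> S1 \<union> S2" for x
    using that inner1 inner2 bridge u1 u2 by (meson UnE rtranclp_trans)
  then have conn: "\<forall>x\<in>S1 \<union> S2. \<forall>y\<in>S1 \<union> S2. ?R\<^sup>*\<^sup>* x y"
    by (meson rtranclp_trans)
  \<comment> \<open>A common edge would lie inside \<open>S1 \<inter> S2\<close>, hence be empty,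
    and edges of a graph are nonempty. This makes the edge count additive.\<close>
  have "F1 \<inter> F2 = {}"
  proof -
    have "{} \<notin> F1"
      using G t1 unfolding is_graph_def is_tree_def by blast
    moreover have "e = {}" if "e \<in> F1" "e \<in> F2" for e
      using sub1 sub2 disj that by blast
    ultimately show ?thesis by blast
  qed
  moreover have "{u1, u2} \<notin> F1 \<union> F2"
  proof
    assume "{u1, u2} \<in> F1 \<union> F2"
    then have "{u1, u2} \<subseteq> S1 \<or> {u1, u2} \<subseteq> S2"
      using sub1 sub2 by (metis UnE)
    then show False
      using u1 u2 disj by auto
  qed
  ultimately have "card ?F = card F1 + card F2 + 1"
    using fin by (simp add: card_Un_disjoint)
  moreover have "card (S1 \<union> S2) = card S1 + card S2"
    using fin disj by (simp add: card_Un_disjoint)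
  ultimately have "card ?F + 1 = card (S1 \<union> S2)"
    using t1 t2 unfolding is_tree_def by simp
  moreover have "\<forall>e\<in>?F. e \<subseteq> S1 \<union> S2"
    using sub1 sub2 u1 u2 by blast
  moreover have "S1 \<union> S2 \<noteq> {}" "S1 \<union> S2 \<subseteq> verts G" "?F \<subseteq> edges G"
    using t1 t2 e unfolding is_tree_def by auto
  ultimately show ?thesis
    using conn unfolding is_tree_def by (intro conjI)
qed

section \<open>Decomposition into connected bipartite parts\<close>

text \<open>This is what maximality of a part contradicts: if some 2-coloring gives all neighbours
  of \<open>v\<close> in \<open>P\<close> the same color, then \<open>v\<close> can take the other
  color and hang on \<open>u\<close> as a leaf.\<close>

lemma connected_bipartite_insert:
  assumes G: "is_graph G" and P: "connected_bipartite G P" and v: "v \<in> verts G" "v \<notin> P"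
    and u: "u \<in> P" "{v, u} \<in> edges G" and no: "\<not> sees_both_sides G v P"
  shows "connected_bipartite G (insert v P)"
proof -
  obtain F where F: "is_tree G P F"
    using P unfolding connected_bipartite_def by blast
  obtain col where col: "two_coloring_on G col P"
    and mono: "\<And>x y. x \<in> P \<Longrightarrow> y \<in> P \<Longrightarrow> {v, x} \<in> edges G \<Longrightarrow> {v, y} \<in> edges G \<Longrightarrow> col x = col y"
    using no unfolding sees_both_sides_def by blast
  have "is_tree G ({v} \<union> P) (insert {v, u} ({} \<union> F))"
    using is_tree_join[OF G is_tree_singleton[OF v(1)] F] v(2) u by simp
  moreover have "two_coloring_on G (col(v := \<not> col u)) (insert v P)"
    unfolding two_coloring_on_def
  proof (intro ballI impI)
    fix x y
    assume xy: "x \<in> insert v P" "y \<in> insert v P" "{x, y} \<in> edges G"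
    then have "x \<noteq> y"
      using edge_endpoints[OF G] by blast
    moreover have "{y, x} \<in> edges G"
      using xy(3) by (simp add: insert_commute)
    ultimately show "(col(v := \<not> col u)) x \<noteq> (col(v := \<not> col u)) y"
      using xy col mono[OF u(1) _ u(2)] unfolding two_coloring_on_def by auto
  qed
  ultimately show ?thesis
    unfolding connected_bipartite_def by (metis insert_is_Un)
qed

text \<open>Remove a connected bipartite \<open>P \<subseteq> W\<close> of maximum size and recurse
  on \<open>W - P\<close>. Of two adjacent parts, the one removed first is seen on both sides from
  the other, which explains the disjunction. Labels are vertices of \<open>W\<close>, so that the
  recursion leaves every vertex of \<open>P\<close> available as a fresh label.\<close>

lemma connected_bipartite_decomposition:
  assumes G: "is_graph G" and W: "W \<subseteq> verts G"
  shows "\<exists>h. h ` W \<subseteq> W \<and>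
    (\<forall>i\<in>h ` W. connected_bipartite G {v\<in>W. h v = i}) \<and>
    (\<forall>u\<in>W. \<forall>v\<in>W. {u, v} \<in> edges G \<and> h u \<noteq> h v \<longrightarrow>
       sees_both_sides G u {x\<in>W. h x = h v} \<or> sees_both_sides G v {x\<in>W. h x = h u})"
  using W
proof (induction "card W" arbitrary: W rule: less_induct)
  case less
  have finW: "finite W"
    using less.prems G finite_subset unfolding is_graph_def by blast
  show ?case
  proof (cases "W = {}")
    case True
    then show ?thesis by simp
  next
    case False
    then obtain w where w: "w \<in> W" by blast
    let ?Q = "\<lambda>P. P \<subseteq> W \<and> connected_bipartite G P"
    have "two_coloring_on G (\<lambda>_. True) {w}"
      unfolding two_coloring_on_def using edge_endpoints(3)[OF G] by blast
    then have "?Q {w}"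
      using w less.prems is_tree_singleton[of w G] unfolding connected_bipartite_def by blast
    moreover have "\<forall>P. ?Q P \<longrightarrow> card P < Suc (card W)"
      using finW card_mono le_imp_less_Suc by blast
    ultimately have "\<exists>P. ?Q P \<and> (\<forall>P'. ?Q P' \<longrightarrow> card P' \<le> card P)"
      by (rule ex_has_greatest_nat[where P = ?Q])
    then obtain P where P: "?Q P" and maxP: "\<And>P'. ?Q P' \<Longrightarrow> card P' \<le> card P"
      by (elim exE conjE) simp
    have "P \<noteq> {}"
      using P unfolding connected_bipartite_def is_tree_def by blast
    then obtain p where p: "p \<in> P" by blast
    have sees: "sees_both_sides G v P" if "v \<in> W - P" "u \<in> P" "{v, u} \<in> edges G" for u v
    proof (rule ccontr)
      assume "\<not> sees_both_sides G v P"
      then have "?Q (insert v P)"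
        using connected_bipartite_insert[OF G] P that less.prems by blast
      then have "card (insert v P) \<le> card P"
        by (rule maxP)
      then show False
        using that P finW finite_subset by fastforce
    qed
    have smaller: "card (W - P) < card W"
      using finW P p by (intro psubset_card_mono) auto
    have "W - P \<subseteq> verts G"
      using less.prems by blast
    from less.hyps[OF smaller this] obtain h where hW: "h ` (W - P) \<subseteq> W - P"
      and hc: "\<forall>i\<in>h ` (W - P). connected_bipartite G {v\<in>W - P. h v = i}"
      and hs: "\<forall>u\<in>W - P. \<forall>v\<in>W - P. {u, v} \<in> edges G \<and> h u \<noteq> h v \<longrightarrow>
        sees_both_sides G u {x\<in>W - P. h x = h v} \<or> sees_both_sides G v {x\<in>W - P. h x = h u}"
      by (elim exE conjE)
    \<comment> \<open>The label \<open>p\<close> lies in \<open>P\<close>, while \<open>h\<close>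
      maps \<open>W - P\<close> into itself; so no old class merges with \<open>P\<close>.\<close>
    define h' where "h' = (\<lambda>x. if x \<in> P then p else h x)"
    have classP: "{x\<in>W. h' x = p} = P"
      using P p hW unfolding h'_def by auto
    have class_eq: "{x\<in>W. h' x = h v} = {x\<in>W - P. h x = h v}" if "v \<in> W - P" for v
      using that P p hW unfolding h'_def by auto
    have h'P: "h' x = p" if "x \<in> P" for x
      using that unfolding h'_def by simp
    have h'W: "h' x = h x" if "x \<in> W - P" for x
      using that unfolding h'_def by simp
    have "h' ` W \<subseteq> W"
      using hW P p unfolding h'_def by auto
    moreover have "connected_bipartite G {v\<in>W. h' v = h' x}" if "x \<in> W" for x
      using that P hc by (cases "x \<in> P") (simp_all add: h'P h'W classP class_eq)
    moreover have "sees_both_sides G u {x\<in>W. h' x = h' v} \<or> sees_both_sides G v {x\<in>W. h' x = h' u}"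
      if "u \<in> W" "v \<in> W" "{u, v} \<in> edges G" "h' u \<noteq> h' v" for u v
    proof -
      have sym: "{v, u} \<in> edges G"
        using that by (simp add: insert_commute)
      show ?thesis
        using that sym sees[of u v] sees[of v u] hs
        by (cases "u \<in> P"; cases "v \<in> P") (simp_all add: h'P h'W classP class_eq)
    qed
    ultimately show ?thesis by blast
  qed
qed

section \<open>Lifting trees and minors from the contraction\<close>

text \<open>A largest nonempty \<open>A \<subseteq> S\<close> with \<open>Q A\<close> is closed
  under the edges in \<open>F\<close>, for otherwise \<open>step\<close> would enlarge it;
  connectivity of the tree then gives \<open>A = S\<close>.\<close>

lemma tree_induct [consumes 2, case_names singleton grow]:
  assumes G: "is_graph G" and tree: "is_tree G S F"
    and base: "\<And>s. s \<in> S \<Longrightarrow> Q {s}"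
    and step: "\<And>A u v. A \<subseteq> S \<Longrightarrow> Q A \<Longrightarrow> u \<in> A \<Longrightarrow> v \<in> S - A \<Longrightarrow> {u, v} \<in> edges G \<Longrightarrow> Q (insert v A)"
  shows "Q S"
proof -
  have finS: "finite S"
    using is_tree_finite[OF tree] by blast
  obtain s where s: "s \<in> S"
    using tree unfolding is_tree_def by blast
  let ?R = "\<lambda>A. A \<subseteq> S \<and> A \<noteq> {} \<and> Q A"
  have "?R {s}"
    using s base by blast
  moreover have "\<forall>A. ?R A \<longrightarrow> card A < Suc (card S)"
    using finS card_mono le_imp_less_Suc by blast
  ultimately have "\<exists>A. ?R A \<and> (\<forall>B. ?R B \<longrightarrow> card B \<le> card A)"
    by (rule ex_has_greatest_nat[where P = ?R])
  then obtain A where A: "?R A" and maxA: "\<And>B. ?R B \<Longrightarrow> card B \<le> card A"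
    by (elim exE conjE) simp
  have finA: "finite A"
    using A finS finite_subset by blast
  have closed: "v \<in> A" if "u \<in> A" "{u, v} \<in> F" for u v
  proof (rule ccontr)
    assume v: "v \<notin> A"
    have "v \<in> S" "{u, v} \<in> edges G"
      using tree that unfolding is_tree_def by auto
    then have "?R (insert v A)"
      using A that v step by blast
    then have "card (insert v A) \<le> card A"
      by (rule maxA)
    then show False
      using v finA by simp
  qed
  obtain a where a: "a \<in> A"
    using A by blast
  have "y \<in> A" if "y \<in> S" for y
  proof -
    have "(\<lambda>x y. {x, y} \<in> F)\<^sup>*\<^sup>* a y"
      using tree a A that unfolding is_tree_def by blast
    then show ?thesis
      by induction (use a closed in auto)
  qed
  then have "A = S"
    using A by blast
  then show ?thesis
    using A by blast
qed

lemma is_graph_contraction: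
  assumes "is_graph G"
  shows "is_graph (contraction G h)"
  using assms unfolding is_graph_def contraction_def verts_def edges_def by auto

lemma tree_proper_if_two_coloring_on:
  assumes "is_tree G P F" "two_coloring_on G col P" "{x, y} \<in> F"
  shows "col x \<noteq> col y"
proof -
  have "{x, y} \<in> edges G" "{x, y} \<subseteq> P"
    using assms(1,3) unfolding is_tree_def by blast+
  then show ?thesis
    using assms(2) unfolding two_coloring_on_def by simp
qed

text \<open>Parts are attached one at a time through a single edge of \<open>G\<close>, and the
  bipartition of the new part is swapped if that edge would be monochromatic. The coloring stays
  proper on each whole part, so that \<open>sees_both_sides\<close> can be applied to it
  afterwards.\<close>

lemma lift_tree_contraction:
  assumes G: "is_graph G"
    and parts: "\<forall>i\<in>h ` verts G. connected_bipartite G {v\<in>verts G. h v = i}"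
    and tree: "is_tree (contraction G h) S F"
  shows "\<exists>col F'. is_tree G {v\<in>verts G. h v \<in> S} F' \<and>
    (\<forall>x y. {x, y} \<in> F' \<longrightarrow> col x \<noteq> col y) \<and>
    (\<forall>i\<in>S. two_coloring_on G col {v\<in>verts G. h v = i})"
proof -
  have SV: "S \<subseteq> h ` verts G"
    using tree unfolding is_tree_def contraction_def verts_def by auto
  show ?thesis
    using is_graph_contraction[OF G] tree
  proof (induction rule: tree_induct)
    case (singleton s)
    then have "connected_bipartite G {v\<in>verts G. h v = s}"
      using parts SV by blast
    then obtain F' col where F': "is_tree G {v\<in>verts G. h v = s} F'"
      and col: "two_coloring_on G col {v\<in>verts G. h v = s}"
      unfolding connected_bipartite_def by (elim exE conjE)
    then show ?case
      using tree_proper_if_two_coloring_on[OF F' col] by auto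
  next
    case (grow A a i)
    let ?P = "{v\<in>verts G. h v = i}"
    let ?L = "{v\<in>verts G. h v \<in> A}"
    obtain col F' where F': "is_tree G ?L F'"
      and pr: "\<forall>x y. {x, y} \<in> F' \<longrightarrow> col x \<noteq> col y"
      and cl: "\<forall>j\<in>A. two_coloring_on G col {v\<in>verts G. h v = j}"
      using grow.IH by (elim exE conjE)
    have "connected_bipartite G ?P"
      using grow.hyps parts SV by blast
    then obtain FP colP where FP: "is_tree G ?P FP" and colP: "two_coloring_on G colP ?P"
      unfolding connected_bipartite_def by (elim exE conjE)
    obtain u0 v0 where uv0: "{a, i} = {h u0, h v0}" "{u0, v0} \<in> edges G" "u0 \<in> verts G" "v0 \<in> verts G"
      using grow.hyps(4) unfolding contraction_def edges_def by auto
    \<comment> \<open>Edges of the contraction are unordered, so the underlying edge may have to be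
      read backwards.\<close>
    obtain u v where u: "u \<in> ?L" "h u = a" and v: "v \<in> ?P" and e: "{u, v} \<in> edges G"
    proof (cases "h u0 = a \<and> h v0 = i")
      case True
      then show ?thesis
        using that[of u0 v0] uv0 grow.hyps(2) by simp
    next
      case False
      then have "h v0 = a \<and> h u0 = i"
        using uv0(1) by (auto simp: doubleton_eq_iff)
      then show ?thesis
        using that[of v0 u0] uv0 grow.hyps(2) by (simp add: insert_commute)
    qed
    \<comment> \<open>The inequality of Booleans \<open>colP x \<noteq> flip\<close> is exclusive
      or: the sides are exchanged exactly when \<open>u\<close> and \<open>v\<close> would otherwise
      agree.\<close>
    define flip where "flip \<longleftrightarrow> colP v = col u"
    define col' where "col' = (\<lambda>x. if h x = i then colP x \<noteq> flip else col x)"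
    have colP': "two_coloring_on G col' ?P"
      using colP unfolding two_coloring_on_def col'_def by auto
    have iA: "i \<notin> A"
      using grow.hyps(3) by blast
    have disj: "?L \<inter> ?P = {}"
      using iA by auto
    have union: "?L \<union> ?P = {v\<in>verts G. h v \<in> insert i A}"
      by auto
    have "is_tree G {v\<in>verts G. h v \<in> insert i A} (insert {u, v} (F' \<union> FP))"
      using is_tree_join[OF G F' FP disj u(1) v e] unfolding union .
    moreover have "col' x \<noteq> col' y" if xy: "{x, y} \<in> insert {u, v} (F' \<union> FP)" for x y
    proof -
      have uv: "col' u \<noteq> col' v"
        using u v iA unfolding col'_def flip_def by auto
      consider "{x, y} = {u, v}" | "{x, y} \<in> F'" | "{x, y} \<in> FP"
        using xy by blast
      then show ?thesis
      proof cases
        case 1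
        then show ?thesis
          using uv by (auto simp: doubleton_eq_iff)
      next
        case 2
        then have "{x, y} \<subseteq> ?L"
          using F' unfolding is_tree_def by blast
        then have "h x \<noteq> i" "h y \<noteq> i"
          using iA by auto
        then show ?thesis
          using pr 2 unfolding col'_def by auto
      next
        case 3
        then show ?thesis
          using tree_proper_if_two_coloring_on[OF FP colP'] by blast
      qed
    qed
    moreover have "two_coloring_on G col' {v\<in>verts G. h v = j}" if "j \<in> insert i A" for j
    proof (cases "j = i")
      case True
      then show ?thesis
        using colP' by simp
    next
      case False
      then have "two_coloring_on G col {v\<in>verts G. h v = j}"
        using that cl by blast
      then show ?thesis
        using False unfolding two_coloring_on_def col'_def by auto
    qed
    ultimately show ?case by blast
  qed
qed

text \<open>An edge between two branch sets of the contraction comes from an edge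
  \<open>{u, v}\<close> between two parts. One end sees both sides of the other part, so its edges
  into that part include a monochromatic and a properly colored one.\<close>

lemma even_odd_minor_if_contraction_minor:
  assumes G: "is_graph G"
    and parts: "\<forall>i\<in>h ` verts G. connected_bipartite G {v\<in>verts G. h v = i}"
    and sees: "\<forall>u\<in>verts G. \<forall>v\<in>verts G. {u, v} \<in> edges G \<and> h u \<noteq> h v \<longrightarrow>
       sees_both_sides G u {x\<in>verts G. h x = h v} \<or> sees_both_sides G v {x\<in>verts G. h x = h u}"
    and minor: "has_Kt_minor (contraction G h) t"
  shows "has_even_odd_Kt_minor G t"
proof -
  let ?part = "\<lambda>i. {v\<in>verts G. h v = i}"
  obtain T where T: "disjoint_trees (contraction G h) t T"
    and adj: "\<And>i j. i < t \<Longrightarrow> j < t \<Longrightarrow> i \<noteq> j \<Longrightarrow>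
      \<exists>u\<in>fst (T i). \<exists>v\<in>fst (T j). {u, v} \<in> edges (contraction G h)"
    using minor unfolding has_Kt_minor_def by blast
  let ?L = "\<lambda>i. {v\<in>verts G. h v \<in> fst (T i)}"
  have disj: "i = j" if "i < t" "j < t" "x \<in> fst (T i)" "x \<in> fst (T j)" for i j x
    using T that unfolding disjoint_trees_def by blast
  define lift where "lift = (\<lambda>i col F. is_tree G (?L i) F \<and>
    (\<forall>x y. {x, y} \<in> F \<longrightarrow> col x \<noteq> col y) \<and> (\<forall>k\<in>fst (T i). two_coloring_on G col (?part k)))"
  have "\<forall>i\<in>{..<t}. \<exists>col F. lift i col F"
  proof
    fix i assume "i \<in> {..<t}"
    then have "is_tree (contraction G h) (fst (T i)) (snd (T i))"
      using T unfolding disjoint_trees_def by blast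
    then show "\<exists>col F. lift i col F"
      unfolding lift_def by (rule lift_tree_contraction[OF G parts])
  qed
  then obtain cols F where "\<And>i. i < t \<Longrightarrow> lift i (cols i) (F i)"
    unfolding lessThan_iff Ball_def by metis
  then have F: "\<And>i. i < t \<Longrightarrow> is_tree G (?L i) (F i)"
    and pr: "\<And>i x y. i < t \<Longrightarrow> {x, y} \<in> F i \<Longrightarrow> cols i x \<noteq> cols i y"
    and cl: "\<And>i k. i < t \<Longrightarrow> k \<in> fst (T i) \<Longrightarrow> two_coloring_on G (cols i) (?part k)"
    unfolding lift_def by blast+
  \<comment> \<open>The branch sets of labels are disjoint, so the colorings of the separate lifts
    glue; the value outside all lifts is irrelevant.\<close>
  define col where "col = (\<lambda>x. cols (THE i. i < t \<and> h x \<in> fst (T i)) x)"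
  have col_eq: "col x = cols i x" if "i < t" "h x \<in> fst (T i)" for i x
  proof -
    have "(THE i. i < t \<and> h x \<in> fst (T i)) = i"
      using that disj by blast
    then show ?thesis
      unfolding col_def by simp
  qed
  have colpart: "two_coloring_on G col (?part k)" if "i < t" "k \<in> fst (T i)" for i k
    using cl[OF that] col_eq[OF that(1)] that unfolding two_coloring_on_def by auto
  \<comment> \<open>The Boolean \<open>b\<close> treats both kinds of edges at once:
    \<open>True\<close> stands for monochromatic, \<open>False\<close> for properly colored.\<close>
  have both: "\<exists>u\<in>?L i. \<exists>v\<in>?L j. {u, v} \<in> edges G \<and> (col u = col v) = b"
    if ij: "i < t" "j < t" "i \<noteq> j" for i j b
  proof -
    obtain a k where ak: "a \<in> fst (T i)" "k \<in> fst (T j)" "{a, k} \<in> edges (contraction G h)"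
      using adj[OF ij] by blast
    have "a \<noteq> k"
      using ak disj ij by blast
    obtain u0 v0 where uv0: "{a, k} = {h u0, h v0}" "{u0, v0} \<in> edges G" "u0 \<in> verts G" "v0 \<in> verts G"
      using ak(3) unfolding contraction_def edges_def by auto
    obtain u v where u: "u \<in> verts G" "h u = a" and v: "v \<in> verts G" "h v = k" and e: "{u, v} \<in> edges G"
    proof (cases "h u0 = a \<and> h v0 = k")
      case True
      then show ?thesis
        using that[of u0 v0] uv0 by simp
    next
      case False
      then have "h v0 = a \<and> h u0 = k"
        using uv0(1) by (auto simp: doubleton_eq_iff)
      then show ?thesis
        using that[of v0 u0] uv0 by (simp add: insert_commute)
    qed
    have "sees_both_sides G u (?part k) \<or> sees_both_sides G v (?part a)"
      using sees u v e \<open>a \<noteq> k\<close> by blast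
    then show ?thesis
    proof
      assume "sees_both_sides G u (?part k)"
      then obtain x y where "x \<in> ?part k" "y \<in> ?part k" "{u, x} \<in> edges G" "{u, y} \<in> edges G" "col x \<noteq> col y"
        using colpart[OF ij(2) ak(2)] unfolding sees_both_sides_def by blast
      \<comment> \<open>Since \<open>col x\<close> and \<open>col y\<close> are different Booleans,
        exactly one of \<open>x\<close> and \<open>y\<close> has the color of
        \<open>u\<close>.\<close>
      then have "\<exists>v\<in>?part k. {u, v} \<in> edges G \<and> (col u = col v) = b"
        by (cases "(col u = col x) = b") auto
      then show ?thesis
        using u ak by auto
    next
      assume "sees_both_sides G v (?part a)"
      then obtain x y where "x \<in> ?part a" "y \<in> ?part a" "{v, x} \<in> edges G" "{v, y} \<in> edges G" "col x \<noteq> col y"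
        using colpart[OF ij(1) ak(1)] unfolding sees_both_sides_def by blast
      moreover from this have "{x, v} \<in> edges G" "{y, v} \<in> edges G"
        by (simp_all add: insert_commute)
      ultimately have "\<exists>u\<in>?part a. {u, v} \<in> edges G \<and> (col u = col v) = b"
        by (cases "(col x = col v) = b") auto
      then show ?thesis
        using v ak by auto
    qed
  qed
  have proper: "col u \<noteq> col v" if "i < t" "{u, v} \<in> F i" for i u v
  proof -
    have "{u, v} \<subseteq> ?L i"
      using F[OF that(1)] that(2) unfolding is_tree_def by blast
    then show ?thesis
      using pr[OF that] col_eq[OF that(1)] by auto
  qed
  let ?T = "\<lambda>i. (?L i, F i)"
  have "disjoint_trees G t ?T"
    using F disj unfolding disjoint_trees_def by auto
  then show ?thesis
    unfolding has_even_odd_Kt_minor_def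
    using proper both[where b = True] both[where b = False]
    by (intro exI[of _ col] exI[of _ ?T]) auto
qed

section \<open>Coloring the graph from its contraction\<close>

lemma colorable_double_if_contraction_colorable:
  assumes G: "is_graph G"
    and parts: "\<forall>i\<in>h ` verts G. connected_bipartite G {v\<in>verts G. h v = i}"
    and c: "colorable (contraction G h) k"
  shows "colorable G (2 * k)"
proof -
  obtain c where ck: "\<And>v. v \<in> verts G \<Longrightarrow> c (h v) < k"
    and cp: "\<And>u v. {u, v} \<in> edges (contraction G h) \<Longrightarrow> c u \<noteq> c v"
    using c unfolding colorable_def contraction_def verts_def by auto
  have "\<forall>i\<in>h ` verts G. \<exists>col. two_coloring_on G col {v\<in>verts G. h v = i}"
    using parts unfolding connected_bipartite_def by simp
  from bchoice[OF this] obtain col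
    where col: "\<forall>i\<in>h ` verts G. two_coloring_on G (col i) {v\<in>verts G. h v = i}"
    by (elim exE)
  \<comment> \<open>The pair of part color and side is encoded as a number below
    \<open>2 * k\<close>. The side separates neighbours within a part, the part color separates
    neighbours in different parts.\<close>
  define d where "d = (\<lambda>v. 2 * c (h v) + of_bool (col (h v) v))"
  have "d v < 2 * k" if "v \<in> verts G" for v
    using ck[OF that] unfolding d_def by auto
  moreover have "d u \<noteq> d v" if e: "{u, v} \<in> edges G" for u v
  proof (cases "h u = h v")
    case True
    then have "col (h u) u \<noteq> col (h v) v"
      using col[rule_format, of "h u"] edge_endpoints[OF G e] e unfolding two_coloring_on_def by auto
    then show ?thesis
      unfolding d_def using True by auto
  next
    case False
    then have "{h u, h v} \<in> edges (contraction G h)"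
      using edge_endpoints[OF G e] e unfolding contraction_def edges_def by auto
    then have "c (h u) \<noteq> c (h v)"
      by (rule cp)
    then show ?thesis
      unfolding d_def by (auto simp: of_bool_def; presburger)
  qed
  ultimately show ?thesis
    unfolding colorable_def by blast
qed

section \<open>Bounded chromatic number without a clique minor\<close>

lemma is_tree_add_neighbours:
  assumes G: "is_graph G" and S: "\<exists>F. is_tree G S F" and fin: "finite N" and NV: "N \<subseteq> verts G"
    and adj: "\<forall>v\<in>N. \<exists>u\<in>S. {u, v} \<in> edges G"
  shows "\<exists>F. is_tree G (S \<union> N) F"
  using fin NV adj
proof (induction N)
  case empty
  then show ?case
    using S by simp
next
  case (insert v N)
  then obtain F where F: "is_tree G (S \<union> N) F"
    by blast
  show ?case
  proof (cases "v \<in> S")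
    case True
    then show ?thesis
      using F by (metis Un_insert_right UnI1 insert_absorb)
  next
    case False
    obtain u where "u \<in> S" "{u, v} \<in> edges G"
      using insert by blast
    then have "is_tree G ((S \<union> N) \<union> {v}) (insert {u, v} (F \<union> {}))"
      using is_tree_join[OF G F is_tree_singleton[of v]] insert False by simp
    then show ?thesis
      by (metis Un_insert_right sup_bot.right_neutral)
  qed
qed

text \<open>Here \<open>S\<close> is the connected explored set, \<open>W\<close> the uncolored rest
  and \<open>b\<close> the palette of the next layer, the neighbours of \<open>S\<close> in
  \<open>W\<close>. Each layer is dominated by \<open>S\<close>, so \<open>dom\<close> colors it;
  the prescription on \<open>snd (c v)\<close> passes the opposite palette to the vertices adjacent
  to that layer.\<close>

lemma layered_coloring:
  assumes G: "is_graph G" and k: "k > 0"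
    and dom: "\<And>S F U. is_tree G S F \<Longrightarrow> U \<subseteq> verts G \<Longrightarrow> S \<inter> U = {} \<Longrightarrow>
      \<forall>v\<in>U. \<exists>u\<in>S. {u, v} \<in> edges G \<Longrightarrow> colorable (induced G U) k"
    and W: "W \<subseteq> verts G" "S \<inter> W = {}" and S: "S = {} \<or> (\<exists>F. is_tree G S F)"
  shows "\<exists>c :: nat \<Rightarrow> nat \<times> bool. (\<forall>v\<in>W. fst (c v) < k) \<and>
    (\<forall>u\<in>W. \<forall>v\<in>W. {u, v} \<in> edges G \<longrightarrow> c u \<noteq> c v) \<and>
    (\<forall>u\<in>S. \<forall>v\<in>W. {u, v} \<in> edges G \<longrightarrow> snd (c v) = b)"
  using W S
proof (induction "card W" arbitrary: W S b rule: less_induct)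
  case less
  have finW: "finite W"
    using less.prems(1) G finite_subset unfolding is_graph_def by blast
  define N where "N = {v\<in>W. \<exists>u\<in>S. {u, v} \<in> edges G}"
  show ?case
  proof (cases "W = {}")
    case True
    then show ?thesis by simp
  next
    case False
    \<comment> \<open>One round: \<open>M\<close> takes palette \<open>b\<close>, and the induction
      hypothesis colors \<open>W - M\<close> with \<open>S'\<close> explored and palette
      \<open>\<not> b\<close> next. As \<open>M \<subseteq> S'\<close>, edges leaving
      \<open>M\<close> join different palettes.\<close>
    have step: "\<exists>c :: nat \<Rightarrow> nat \<times> bool. (\<forall>v\<in>W. fst (c v) < k) \<and>
        (\<forall>u\<in>W. \<forall>v\<in>W. {u, v} \<in> edges G \<longrightarrow> c u \<noteq> c v) \<and> (\<forall>v\<in>M. snd (c v) = b)"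
      if M: "M \<subseteq> W" "M \<noteq> {}" "\<exists>F. is_tree G S' F" "M \<subseteq> S'" "S' \<inter> (W - M) = {}"
        and col: "colorable (induced G M) k" for M S'
    proof -
      obtain c0 where c0: "\<forall>v\<in>M. c0 v < k" "\<forall>u v. {u, v} \<in> edges G \<and> u \<in> M \<and> v \<in> M \<longrightarrow> c0 u \<noteq> c0 v"
        using col unfolding colorable_def induced_def verts_def edges_def by auto
      have smaller: "card (W - M) < card W"
        using finW M by (intro psubset_card_mono) auto
      have rest: "W - M \<subseteq> verts G" "S' = {} \<or> (\<exists>F. is_tree G S' F)"
        using less.prems(1) M by blast+
      from less.hyps[OF smaller rest(1) M(5) rest(2), of "\<not> b"] obtain c :: "nat \<Rightarrow> nat \<times> bool" where c: "\<forall>v\<in>W - M. fst (c v) < k"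
        "\<forall>u\<in>W - M. \<forall>v\<in>W - M. {u, v} \<in> edges G \<longrightarrow> c u \<noteq> c v"
        "\<forall>u\<in>S'. \<forall>v\<in>W - M. {u, v} \<in> edges G \<longrightarrow> snd (c v) = (\<not> b)"
        by (elim exE conjE)
      define c' where "c' = (\<lambda>v. if v \<in> M then (c0 v, b) else c v)"
      have cross: "c' u \<noteq> c' v" if "u \<in> M" "v \<in> W - M" "{u, v} \<in> edges G" for u v
      proof -
        have "snd (c v) = (\<not> b)"
          using c(3) that M by blast
        then show ?thesis
          using that unfolding c'_def by (metis DiffD2 snd_conv)
      qed
      have "c' u \<noteq> c' v" if "u \<in> W" "v \<in> W" and e: "{u, v} \<in> edges G" for u v
      proof -
        have e': "{v, u} \<in> edges G"
          using e by (simp add: insert_commute)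
        show ?thesis
          using that e' cross[of u v] cross[of v u] c(2) c0(2)
          by (cases "u \<in> M"; cases "v \<in> M") (auto simp: c'_def)
      qed
      moreover have "\<forall>v\<in>W. fst (c' v) < k" "\<forall>v\<in>M. snd (c' v) = b"
        using c(1) c0(1) unfolding c'_def by auto
      ultimately show ?thesis by blast
    qed
    show ?thesis
    proof (cases "N = {}")
      case True
      \<comment> \<open>No edge joins \<open>S\<close> to \<open>W\<close>, so the exploration
        restarts at an arbitrary vertex with \<open>{w}\<close> as explored set; the condition on
        \<open>b\<close> holds vacuously. Coloring \<open>w\<close> is where \<open>k > 0\<close>
        enters.\<close>
      obtain w where w: "w \<in> W"
        using False by blast
      have "colorable (induced G {w}) k"
        unfolding colorable_def induced_def verts_def edges_def
        using k edge_endpoints(3)[OF G] by (auto intro!: exI[of _ "\<lambda>_. 0"] simp: edges_def)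
      then obtain c :: "nat \<Rightarrow> nat \<times> bool" where "\<forall>v\<in>W. fst (c v) < k"
        "\<forall>u\<in>W. \<forall>v\<in>W. {u, v} \<in> edges G \<longrightarrow> c u \<noteq> c v"
        using step[of "{w}" "{w}"] is_tree_singleton w less.prems(1) by blast
      then show ?thesis
        using True unfolding N_def by blast
    next
      case nonempty: False
      \<comment> \<open>A nonempty layer rules out the alternative \<open>S = {}\<close>.\<close>
      then obtain F where F: "is_tree G S F"
        using less.prems(3) unfolding N_def by blast
      have NW: "N \<subseteq> W"
        unfolding N_def by blast
      have "\<forall>v\<in>N. \<exists>u\<in>S. {u, v} \<in> edges G"
        unfolding N_def by blast
      then have "\<exists>F. is_tree G (S \<union> N) F" "colorable (induced G N) k"
        using is_tree_add_neighbours[OF G, of S N] dom[OF F, of N] F NW less.prems finW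
        by (blast intro: finite_subset)+
      then obtain c :: "nat \<Rightarrow> nat \<times> bool" where "\<forall>v\<in>W. fst (c v) < k"
        "\<forall>u\<in>W. \<forall>v\<in>W. {u, v} \<in> edges G \<longrightarrow> c u \<noteq> c v" "\<forall>v\<in>N. snd (c v) = b"
        using step[of N "S \<union> N"] NW nonempty less.prems(2) by blast
      then show ?thesis
        unfolding N_def by blast
    qed
  qed
qed

lemma colorable_mono: "colorable G k \<Longrightarrow> k \<le> l \<Longrightarrow> colorable G l"
  unfolding colorable_def by (elim ex_forward conj_forward) auto

text \<open>The dominating tree serves as an additional branch tree at index \<open>t\<close>: every
  other branch tree contains a vertex of \<open>U\<close>, which has a neighbour in
  \<open>S\<close>.\<close>

lemma Kt_minor_Suc_if_dominated:
  assumes tree: "is_tree G S F" and U: "U \<subseteq> verts G" and disj: "S \<inter> U = {}"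
    and dom: "\<forall>v\<in>U. \<exists>u\<in>S. {u, v} \<in> edges G" and minor: "has_Kt_minor (induced G U) t"
  shows "has_Kt_minor G (Suc t)"
proof -
  obtain T where T: "disjoint_trees (induced G U) t T"
    and adj: "\<forall>i<t. \<forall>j<t. i \<noteq> j \<longrightarrow> (\<exists>u\<in>fst (T i). \<exists>v\<in>fst (T j). {u, v} \<in> edges (induced G U))"
    using minor unfolding has_Kt_minor_def by blast
  define T' where "T' = T(t := (S, F))"
  have old: "is_tree G (fst (T i)) (snd (T i))" "fst (T i) \<subseteq> U" if "i < t" for i
    using is_tree_induced[OF _ U] T that unfolding disjoint_trees_def by blast+
  have toS: "\<exists>u\<in>S. \<exists>v\<in>fst (T i). {u, v} \<in> edges G" if "i < t" for i
  proof -
    obtain v where "v \<in> fst (T i)"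
      using old(1)[OF \<open>i < t\<close>] unfolding is_tree_def by blast
    then show ?thesis
      using old(2)[OF \<open>i < t\<close>] dom by blast
  qed
  have sub: "edges (induced G U) \<subseteq> edges G"
    unfolding induced_def edges_def by auto
  have "disjoint_trees G (Suc t) T'"
    unfolding disjoint_trees_def
  proof (intro conjI allI impI)
    fix i assume "i < Suc t"
    then show "is_tree G (fst (T' i)) (snd (T' i))"
      using old tree unfolding T'_def by (cases "i = t") auto
  next
    fix i j assume "i < Suc t" "j < Suc t" "i \<noteq> j"
    then show "fst (T' i) \<inter> fst (T' j) = {}"
      using old(2)[of i] old(2)[of j] disj T unfolding T'_def disjoint_trees_def
      by (cases "i = t"; cases "j = t") (auto simp: less_Suc_eq)
  qed
  moreover have "\<exists>u\<in>fst (T' i). \<exists>v\<in>fst (T' j). {u, v} \<in> edges G"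
    if ij: "i < Suc t" "j < Suc t" "i \<noteq> j" for i j
  proof -
    consider "i = t" "j < t" | "i < t" "j = t" | "i < t" "j < t"
      using ij by linarith
    then show ?thesis
    proof cases
      case 1
      then show ?thesis
        using toS[of j] unfolding T'_def by simp
    next
      case 2
      then obtain u v where "u \<in> S" "v \<in> fst (T i)" "{u, v} \<in> edges G"
        using toS by blast
      then have "{v, u} \<in> edges G"
        by (simp add: insert_commute)
      then show ?thesis
        using 2 \<open>u \<in> S\<close> \<open>v \<in> fst (T i)\<close> unfolding T'_def by auto
    next
      case 3
      then obtain u v where "u \<in> fst (T i)" "v \<in> fst (T j)" "{u, v} \<in> edges (induced G U)"
        using adj ij(3) by blast
      then show ?thesis
        using 3 sub unfolding T'_def by auto
    qed
  qed
  ultimately show ?thesis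
    unfolding has_Kt_minor_def by blast
qed

text \<open>This guarantees that the least number defining \<open>f t\<close> is attained. Each
  induction step gives a bound of twice the previous bound plus 2.\<close>

lemma Kt_minor_free_bounded_chromatic:
  "\<exists>k. \<forall>G. is_graph G \<and> \<not> has_Kt_minor G t \<longrightarrow> colorable G k"
proof (induction t)
  case 0
  show ?case
    \<comment> \<open>With no branch trees required, every graph has the minor, so there is nothing
      to color.\<close>
    by (simp add: has_Kt_minor_def disjoint_trees_def)
next
  case (Suc t)
  then obtain k0 where k0: "\<And>G. is_graph G \<Longrightarrow> \<not> has_Kt_minor G t \<Longrightarrow> colorable G k0"
    by blast
  \<comment> \<open>The successor ensures the positivity that \<open>layered_coloring\<close>
    demands, since \<open>k0\<close> may be 0.\<close>
  define k where "k = Suc k0"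
  have "colorable G (2 * k)" if G: "is_graph G" and no: "\<not> has_Kt_minor G (Suc t)" for G
  proof -
    have dom: "colorable (induced G U) k" if "is_tree G S F" "U \<subseteq> verts G" "S \<inter> U = {}"
      "\<forall>v\<in>U. \<exists>u\<in>S. {u, v} \<in> edges G" for S F U
    proof -
      have "\<not> has_Kt_minor (induced G U) t"
        using Kt_minor_Suc_if_dominated[OF that] no by blast
      then have "colorable (induced G U) k0"
        using k0 is_graph_induced[OF G that(2)] by blast
      then show ?thesis
        unfolding k_def by (rule colorable_mono) simp
    qed
    have "k > 0"
      unfolding k_def by simp
    \<comment> \<open>The exploration begins with nothing explored; the initial palette
      \<open>True\<close> is arbitrary.\<close>
    have "\<exists>c :: nat \<Rightarrow> nat \<times> bool. (\<forall>v\<in>verts G. fst (c v) < k) \<and>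
      (\<forall>u\<in>verts G. \<forall>v\<in>verts G. {u, v} \<in> edges G \<longrightarrow> c u \<noteq> c v) \<and>
      (\<forall>u\<in>{}. \<forall>v\<in>verts G. {u, v} \<in> edges G \<longrightarrow> snd (c v) = True)"
      by (rule layered_coloring[OF G \<open>k > 0\<close>]) (erule dom | simp)+
    then obtain c :: "nat \<Rightarrow> nat \<times> bool" where c: "\<forall>v\<in>verts G. fst (c v) < k"
      "\<forall>u\<in>verts G. \<forall>v\<in>verts G. {u, v} \<in> edges G \<longrightarrow> c u \<noteq> c v"
      by blast
    define d where "d = (\<lambda>v. 2 * fst (c v) + of_bool (snd (c v)))"
    have "d v < 2 * k" if "v \<in> verts G" for v
    proof -
      have "fst (c v) < k"
        using c(1) that by blast
      then show ?thesis
        unfolding d_def by auto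
    qed
    moreover have "d u \<noteq> d v" if "{u, v} \<in> edges G" for u v
    proof
      assume "d u = d v"
      then have "fst (c u) = fst (c v) \<and> snd (c u) = snd (c v)"
        unfolding d_def by (auto simp: of_bool_def split: if_splits; presburger)
      then show False
        using c(2) edge_endpoints[OF G that] that prod_eqI by blast
    qed
    ultimately show ?thesis
      unfolding colorable_def by blast
  qed
  then show ?case by blast
qed

section \<open>Comparison of the least numbers\<close>

lemma even_odd_imp_odd_Kt_minor: "has_even_odd_Kt_minor G t \<Longrightarrow> has_odd_Kt_minor G t"
  unfolding has_even_odd_Kt_minor_def has_odd_Kt_minor_def
  by (elim ex_forward conj_forward) simp_all

theorem theorem3p7:
  fixes t :: nat
  assumes "t \<ge> 2"
  shows "f_o t \<le> f_eo t \<and> f_eo t \<le> 2 * f t"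
proof
  have f: "colorable G (f t)" if "is_graph G" "\<not> has_Kt_minor G t" for G
    using LeastI_ex[OF Kt_minor_free_bounded_chromatic[of t]] that unfolding f_def by blast
  have double: "\<forall>G. is_graph G \<and> \<not> has_even_odd_Kt_minor G t \<longrightarrow> colorable G (2 * f t)"
  proof (intro allI impI)
    fix G assume G: "is_graph G \<and> \<not> has_even_odd_Kt_minor G t"
    then have "is_graph G" by blast
    from connected_bipartite_decomposition[OF this order_refl] obtain h where
      "h ` verts G \<subseteq> verts G" and
      parts: "\<forall>i\<in>h ` verts G. connected_bipartite G {v\<in>verts G. h v = i}" and
      sees: "\<forall>u\<in>verts G. \<forall>v\<in>verts G. {u, v} \<in> edges G \<and> h u \<noteq> h v \<longrightarrow>
        sees_both_sides G u {x\<in>verts G. h x = h v} \<or> sees_both_sides G v {x\<in>verts G. h x = h u}"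
      by (elim exE conjE)
    have "\<not> has_Kt_minor (contraction G h) t"
      using even_odd_minor_if_contraction_minor[OF _ parts sees] G by blast
    then show "colorable G (2 * f t)"
      using colorable_double_if_contraction_colorable[OF _ parts] f is_graph_contraction G by blast
  qed
  then show "f_eo t \<le> 2 * f t"
    unfolding f_eo_def by (rule Least_le)
  \<comment> \<open>The value \<open>2 * f t\<close> from \<open>double\<close> is also the
    existence witness that makes \<open>f_eo t\<close> itself a valid bound; it carries over to the
    smaller class of graphs without an odd minor.\<close>
  have "\<forall>G. is_graph G \<and> \<not> has_even_odd_Kt_minor G t \<longrightarrow> colorable G (f_eo t)"
    unfolding f_eo_def by (rule LeastI[where k = "2 * f t"]) (rule double)
  then have "\<forall>G. is_graph G \<and> \<not> has_odd_Kt_minor G t \<longrightarrow> colorable G (f_eo t)"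
    using even_odd_imp_odd_Kt_minor by blast
  then show "f_o t \<le> f_eo t"
    unfolding f_o_def by (rule Least_le)
qed

end
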